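(* There is an absolute constant $C_0$ such that for every constant $c_2\ge C_0$ the following holds. Let $\epsilon\in(0,1)$ and let $\mathbf A\in\mathbb R^{n\times n}$ be symmetric with $\|\mathbf A\|_\infty\le1$ and $\mathrm{nnz}(\mathbf A)\ge2/\epsilon^2$. Let $\mathbf A'\in\mathbb R^{n\times n}$ have $\mathbf A'_{ij}=0$ if $i=j$ or $\mathrm{nnz}(\mathbf A_i)\cdot\mathrm{nnz}(\mathbf A_j)<\frac{\epsilon^2\,\mathrm{nnz}(\mathbf A)}{c_2\log^2n}$, and $\mathbf A'_{ij}=\mathbf A_{ij}$ otherwise. Then for all $i\in[n]$, $$|\lambda_i(\mathbf A)-\lambda_i(\mathbf A')|\le\epsilon\sqrt{\mathrm{nnz}(\mathbf A)}.$$
   Context: $[n]=\{1,\dots,n\}$; $\|\mathbf A\|_\infty$ is the largest magnitude of an entry; $\mathbf A_i$ is the $i$-th row of $\mathbf A$; $\mathrm{nnz}(\cdot)$ is the number of nonzero entries; $\lambda_1(\cdot)\ge\dots\ge\lambda_n(\cdot)$ are the eigenvalues of a symmetric matrix in decreasing order. Convention: $\log x$ is read as $\max\{1,\ln x\}$, and $\log^2n=(\log n)^2$. *)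

theory Defs
  imports
    Complex_Main
    "HOL-Library.Multiset"
    "HOL-Computational_Algebra.Polynomial"
    "Jordan_Normal_Form.Char_Poly"
begin

definition nnz_vec :: "real vec \<Rightarrow> nat" where
  "nnz_vec v = card {i. i < dim_vec v \<and> v $ i \<noteq> 0}"

definition nnz_mat :: "real mat \<Rightarrow> nat" where
  "nnz_mat A = card {(i, j). i < dim_row A \<and> j < dim_col A \<and> A $$ (i, j) \<noteq> 0}"

(* The inserted 0 only matters for the empty matrix, where it keeps Max defined. *)
definition max_abs_entry :: "real mat \<Rightarrow> real" where
  "max_abs_entry A = Max (insert 0 (abs ` elements_mat A))"

definition symmetric_real_mat :: "real mat \<Rightarrow> bool" where
  "symmetric_real_mat A \<longleftrightarrow> transpose_mat A = A"

definition trunc_log :: "real \<Rightarrow> real" where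
  "trunc_log x = max 1 (ln x)"

(* All real eigenvalues with algebraic multiplicity, in decreasing order. A symmetric real
   n x n matrix has a characteristic polynomial that splits over the reals, so then the list
   has length n. *)
definition eigvals_desc :: "real mat \<Rightarrow> real list" where
  "eigvals_desc A = rev (sorted_list_of_multiset (proots (char_poly A)))"

(* 1-based: eigval_desc A 1 is the largest eigenvalue. *)
definition eigval_desc :: "real mat \<Rightarrow> nat \<Rightarrow> real" where
  "eigval_desc A i = eigvals_desc A ! (i - 1)"

end

theory Submission
  imports Defs "Jordan_Normal_Form.Schur_Decomposition"
begin

text \<open>
  By Weyl's inequality it suffices to bound the quadratic form of \<open>A - A'\<close> by
  \<open>\<epsilon> * sqrt (nnz A) * (x \<bullet> x)\<close>. Write \<open>d i\<close> for the number of nonzero entries in row \<open>i\<close> of \<open>A\<close>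
  and \<open>t\<close> for the threshold in the definition of \<open>A'\<close>. The off-diagonal part of \<open>A - A'\<close> is treated
  by a Schur test with weights \<open>sqrt (d i)\<close>: a removed entry has \<open>d i * d j < t\<close>, so row \<open>i\<close>
  contributes at most \<open>d i * sqrt (t / d i) = sqrt t * sqrt (d i)\<close>. Together with the diagonal, the
  norm is at most \<open>1 + sqrt t\<close>, and \<open>sqrt t \<le> \<epsilon> * sqrt (nnz A) / 4\<close> as soon as \<open>c\<^sub>2 \<ge> 16\<close>, while
  \<open>1 \<le> 3 / 4 * (\<epsilon> * sqrt (nnz A))\<close> since \<open>nnz A \<ge> 2 / \<epsilon>\<^sup>2\<close>.
\<close>

section \<open>The spectral theorem for real symmetric matrices\<close>

lemma scalar_prod_self_nonneg: "0 \<le> v \<bullet> (v :: real vec)"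
  by (simp add: scalar_prod_def sum_nonneg)

lemma scalar_prod_self_pos:
  assumes "v \<in> carrier_vec n" "v \<noteq> 0\<^sub>v n"
  shows "0 < v \<bullet> (v :: real vec)"
  using assms conjugate_square_greater_0_vec[of v n] by simp

lemma symmetric_real_matD:
  assumes "symmetric_real_mat A" "A \<in> carrier_mat n n" "i < n" "j < n"
  shows "A $$ (i, j) = A $$ (j, i)"
  using assms unfolding symmetric_real_mat_def by (metis carrier_matD index_transpose_mat(1))

lemma symmetric_congruence:
  assumes S: "symmetric_real_mat A" and A: "A \<in> carrier_mat n n" and W: "W \<in> carrier_mat n n"
  shows "symmetric_real_mat (W\<^sup>T * A * W)"
proof -
  have "(W\<^sup>T * A * W)\<^sup>T = W\<^sup>T * (W\<^sup>T * A)\<^sup>T"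
    using A W by (intro transpose_mult) auto
  also have "(W\<^sup>T * A)\<^sup>T = A * W"
    using transpose_mult[of "W\<^sup>T" n n A n] A W S by (simp add: symmetric_real_mat_def)
  finally show ?thesis
    using A W unfolding symmetric_real_mat_def by (simp add: assoc_mult_mat[of _ n n _ n _ n])
qed

section \<open>Reality of the eigenvalues and splitting of the characteristic polynomial\<close>

text \<open>Moving the real symmetric matrix from one side of the Hermitian product of an
  eigenvector \<open>v\<close> with itself to the other replaces \<open>z\<close> by its
  conjugate.\<close>

lemma symmetric_complex_root_real:
  assumes S: "symmetric_real_mat A" and A: "A \<in> carrier_mat n n"
    and root: "poly (char_poly (map_mat complex_of_real A)) z = 0"
  shows "z \<in> \<real>"
proof -
  let ?A = "map_mat complex_of_real A"
  have cA: "?A \<in> carrier_mat n n" using A by simp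
  obtain v where v: "v \<in> carrier_vec n" "v \<noteq> 0\<^sub>v n" "?A *\<^sub>v v = z \<cdot>\<^sub>v v"
    using root eigenvalue_root_char_poly[OF cA] cA unfolding eigenvalue_def eigenvector_def by auto
  have tA: "?A\<^sup>T = ?A"
    using S A unfolding symmetric_real_mat_def by (metis map_mat_transpose)
  have conj: "conjugate (?A *\<^sub>v v) = ?A *\<^sub>v conjugate v"
    using v(1) A by (intro eq_vecI) (auto simp: scalar_prod_def conjugate_complex_def)
  have "z * (v \<bullet>c v) = (?A *\<^sub>v v) \<bullet>c v"
    using v by simp
  also have "\<dots> = v \<bullet> (?A *\<^sub>v conjugate v)"
    using transpose_vec_mult_scalar[OF cA, of "conjugate v" v] v(1) tA
    by (metis carrier_vec_conjugate)
  also have "\<dots> = v \<bullet>c (z \<cdot>\<^sub>v v)"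
    using conj v(3) by simp
  also have "\<dots> = conjugate z * (v \<bullet>c v)"
    using v(1) by (simp add: conjugate_smult_vec)
  finally have "z = conjugate z"
    using v conjugate_square_eq_0_vec[OF v(1)] by simp
  then show ?thesis
    by (simp add: conjugate_complex_def complex_is_Real_iff complex_eq_iff)
qed

text \<open>The factorization exists over the complex numbers. Its roots are all real, and the
  embedding of real into complex polynomials is injective, so it descends.\<close>

lemma char_poly_symmetric_splits:
  assumes S: "symmetric_real_mat A" and A: "A \<in> carrier_mat n n"
  shows "\<exists>es. char_poly A = (\<Prod>e\<leftarrow>es. [:- e, 1:])"
proof -
  let ?A = "map_mat complex_of_real A"
  obtain zs where zs: "char_poly ?A = (\<Prod>z\<leftarrow>zs. [:- z, 1:])"
    using char_poly_factorized[of ?A n] A by auto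
  have "\<forall>z\<in>set zs. z \<in> \<real>"
    using symmetric_complex_root_real[OF S A] zs by (auto simp: poly_prod_list prod_list_zero_iff)
  then have re: "map (complex_of_real \<circ> Re) zs = zs"
    by (intro map_idI) (auto simp: complex_is_Real_iff complex_eq_iff)
  interpret ph: map_poly_inj_comm_ring_hom complex_of_real ..
  have "map_poly complex_of_real (char_poly A) = (\<Prod>z\<leftarrow>map (complex_of_real \<circ> Re) zs. [:- z, 1:])"
    unfolding re zs[symmetric] by (rule of_real_hom.char_poly_hom[OF A, symmetric])
  also have "\<dots> = map_poly complex_of_real (\<Prod>e\<leftarrow>map Re zs. [:- e, 1:])"
    by (simp add: ph.hom_prod_list o_def)
  finally have "char_poly A = (\<Prod>e\<leftarrow>map Re zs. [:- e, 1:])"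
    by simp
  then show ?thesis by blast
qed

text \<open>The roots of a split polynomial, with multiplicity, are those of its linear factors, and
  reordering them does not change the product. This lets the sorted list serve as the diagonal in
  the spectral theorem.\<close>

lemma char_poly_eigvals_desc:
  assumes S: "symmetric_real_mat A" and A: "A \<in> carrier_mat n n"
  shows "char_poly A = (\<Prod>e\<leftarrow>eigvals_desc A. [:- e, 1:])"
proof -
  obtain es where es: "char_poly A = (\<Prod>e\<leftarrow>es. [:- e, 1:])"
    using char_poly_symmetric_splits[OF S A] by blast
  have "proots (\<Prod>e\<leftarrow>es. [:- e, 1:]) = mset es" for es :: "real list"
  proof (induction es)
    case (Cons e es)
    have "(\<Prod>e\<leftarrow>es. [:- e, 1:]) \<noteq> 0"
      by (auto simp: prod_list_zero_iff)
    then have "proots ([:- e, 1:] * (\<Prod>e\<leftarrow>es. [:- e, 1:])) = {#e#} + mset es"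
      by (subst proots_mult) (simp_all only: Cons.IH proots_linear_factor minus_minus, simp_all)
    then show ?case by simp
  qed simp
  then have "mset (eigvals_desc A) = mset es"
    using es by (simp add: eigvals_desc_def)
  then have "prod_mset (image_mset (\<lambda>e. [:- e, 1:]) (mset (eigvals_desc A)))
      = prod_mset (image_mset (\<lambda>e. [:- e, 1:]) (mset es))"
    by simp
  then show ?thesis
    unfolding es by (simp flip: prod_mset_prod_list)
qed

lemma length_eigvals_desc:
  assumes "symmetric_real_mat A" "A \<in> carrier_mat n n"
  shows "length (eigvals_desc A) = n"
  using degree_monic_char_poly[OF assms(2)] degree_linear_factors[of uminus "eigvals_desc A"]
    char_poly_eigvals_desc[OF assms] by simp

lemma eigvals_desc_antimono:
  assumes "i \<le> j" "j < length (eigvals_desc A)"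
  shows "eigvals_desc A ! j \<le> eigvals_desc A ! i"
  using assms unfolding eigvals_desc_def by (auto simp: rev_nth intro!: sorted_nth_mono)


section \<open>Orthogonal diagonalization by deflation\<close>

text \<open>Complete \<open>v\<close> to a basis, apply Gram-Schmidt, which leaves the first vector
  unchanged, and normalize.\<close>

lemma orthogonal_matrix_extending:
  assumes v: "v \<in> carrier_vec n" "v \<noteq> 0\<^sub>v n"
  obtains W c where "W \<in> carrier_mat n n" "W\<^sup>T * W = 1\<^sub>m n" "col W 0 = c \<cdot>\<^sub>v (v :: real vec)"
proof -
  interpret cof_vec_space n "TYPE(real)" .
  define b where "b = basis_completion v"
  define ws where "ws = gram_schmidt n b"
  note bc = basis_completion[OF v, folded b_def]
  have ws: "set ws \<subseteq> carrier_vec n" "corthogonal ws" "length ws = n"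
    using gram_schmidt_result[OF bc(2) bc(4) bc(5) ws_def] bc(6) by auto
  have n: "0 < n"
    using v by (cases n) auto
  then obtain vs where "b = v # vs"
    using bc(6,7) by (cases b) auto
  then have hd: "ws ! 0 = v"
    using gram_schmidt_hd[OF v(1), of vs] ws(3) n by (metis hd_conv_nth length_0_conv less_numeral_extra(3) ws_def)
  define u where "u w = (1 / sqrt (w \<bullet> w)) \<cdot>\<^sub>v w" for w :: "real vec"
  have wi: "ws ! i \<in> carrier_vec n" if "i < n" for i
    using that ws by auto
  define W where "W = mat_of_cols n (map u ws)"
  have W: "W \<in> carrier_mat n n"
    unfolding W_def using mat_of_cols_carrier(1)[of n "map u ws"] ws(3) by simp
  have col: "col W i = u (ws ! i)" if "i < n" for i
    unfolding W_def using that ws(3) wi[OF that] by (subst col_mat_of_cols) (auto simp: u_def)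
  have orth: "col W i \<bullet> col W j = (if i = j then 1 else 0)" if "i < n" "j < n" for i j
  proof -
    \<comment> \<open>The case \<open>i = j\<close> says that no vector has norm 0, so the
      normalization in \<open>u\<close> is sound.\<close>
    have "(ws ! i \<bullet> ws ! j = 0) = (i \<noteq> j)"
      using corthogonalD[OF ws(2), of i j] that ws(3) by simp
    moreover have "col W i \<bullet> col W j = (ws ! i \<bullet> ws ! j) / (sqrt (ws ! i \<bullet> ws ! i) * sqrt (ws ! j \<bullet> ws ! j))"
      using wi[OF that(1)] wi[OF that(2)] by (simp add: col that u_def)
    ultimately show ?thesis
      using scalar_prod_self_nonneg[of "ws ! i"] by (auto simp: real_sqrt_mult_self)
  qed
  have "W\<^sup>T * W = 1\<^sub>m n"
    using W by (intro eq_matI) (auto simp: orth)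
  moreover have "col W 0 = (1 / sqrt (v \<bullet> v)) \<cdot>\<^sub>v v"
    using col[OF n] hd by (simp add: u_def)
  ultimately show ?thesis
    using that W by blast
qed

text \<open>Induction on the roots: split off an eigenvector for the first one and recurse on its
  orthogonal complement. The diagonal keeps the order of \<open>es\<close>, so it can later be taken
  decreasing.\<close>

lemma spectral_theorem_of_split:
  assumes "symmetric_real_mat A" "A \<in> carrier_mat n n" "char_poly A = (\<Prod>e\<leftarrow>es. [:- e, 1:])"
  shows "\<exists>P \<in> carrier_mat n n. P\<^sup>T * P = 1\<^sub>m n \<and> P\<^sup>T * A * P = mat_diag n ((!) es)"
  using assms
proof (induction es arbitrary: n A)
  case Nil
  then have "n = 0"
    using degree_monic_char_poly[of A n] by simp
  then show ?case
    by (intro bexI[of _ "1\<^sub>m 0"]) (use Nil in \<open>auto intro!: eq_matI simp: mat_diag_def\<close>)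
next
  case (Cons e es)
  note A = Cons.prems(2)
  define q where "q = (\<Prod>e\<leftarrow>es. [:- e, 1:])"
  have cp: "char_poly A = [:- e, 1:] * q"
    using Cons.prems(3) by (simp add: q_def)
  have "poly (char_poly A) e = 0"
    by (simp add: cp)
  then obtain v where v: "v \<in> carrier_vec n" "v \<noteq> 0\<^sub>v n" "A *\<^sub>v v = e \<cdot>\<^sub>v v"
    using eigenvalue_root_char_poly[OF A] A unfolding eigenvalue_def eigenvector_def by auto
  obtain m where m: "n = Suc m"
    using v(1,2) by (cases n) auto
  obtain W c where W: "W \<in> carrier_mat n n" "W\<^sup>T * W = 1\<^sub>m n" and col0: "col W 0 = c \<cdot>\<^sub>v v"
    using orthogonal_matrix_extending[OF v(1,2)] by blast
  have WW: "W * W\<^sup>T = 1\<^sub>m n"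
    using mat_mult_left_right_inverse[of "W\<^sup>T" n W] W by simp
  \<comment> \<open>This is \<open>A\<close> in an orthonormal basis whose first vector is an
    eigenvector for \<open>e\<close>.\<close>
  define B where "B = W\<^sup>T * A * W"
  have B: "B \<in> carrier_mat n n" and symB: "symmetric_real_mat B"
    using W A symmetric_congruence[OF Cons.prems(1) A W(1)] by (auto simp: B_def)
  have B0: "B $$ (i, 0) = (if i = 0 then e else 0)" if i: "i < n" for i
  proof -
    have "B $$ (i, 0) = col W i \<bullet> (A *\<^sub>v col W 0)"
      using i m W A unfolding B_def by (subst assoc_mult_mat[of _ n n _ n _ n]) (auto simp: mult_mat_vec_def)
    also have "A *\<^sub>v col W 0 = e \<cdot>\<^sub>v col W 0"
      using A v W(1) by (simp add: col0 mult_mat_vec[of _ n n] smult_smult_assoc mult.commute)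
    also have "col W i \<bullet> (e \<cdot>\<^sub>v col W 0) = e * (W\<^sup>T * W) $$ (i, 0)"
      using i m W(1) by simp
    finally show ?thesis
      using W(2) i m by simp
  qed
  define A1 where "A1 = mat 1 1 (\<lambda>_. e)"
  define A3 where "A3 = mat m m (\<lambda>(i, j). B $$ (Suc i, Suc j))"
  have A1: "A1 \<in> carrier_mat 1 1" and A3: "A3 \<in> carrier_mat m m"
    by (auto simp: A1_def A3_def)
  \<comment> \<open>The first column is known from the eigenvector; symmetry transfers it to the
    first row.\<close>
  have Bblock: "B = four_block_mat A1 (0\<^sub>m 1 m) (0\<^sub>m m 1) A3"
  proof (rule eq_matI)
    fix i j
    assume "i < dim_row (four_block_mat A1 (0\<^sub>m 1 m) (0\<^sub>m m 1) A3)"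
      and "j < dim_col (four_block_mat A1 (0\<^sub>m 1 m) (0\<^sub>m m 1) A3)"
    then have "i < n" "j < n"
      by (auto simp: A1_def A3_def m)
    then show "B $$ (i, j) = four_block_mat A1 (0\<^sub>m 1 m) (0\<^sub>m m 1) A3 $$ (i, j)"
      using B0[of i] B0[of j] symmetric_real_matD[OF symB B, of 0 j]
      by (cases i; cases j) (auto simp: A1_def A3_def m)
  qed (use B in \<open>auto simp: A1_def A3_def m\<close>)
  have symA3: "symmetric_real_mat A3"
    unfolding symmetric_real_mat_def A3_def
    using symmetric_real_matD[OF symB B] m by (intro eq_matI) auto
  \<comment> \<open>Similarity preserves the characteristic polynomial, so cancelling the factor of
    \<open>e\<close> shows that the roots of \<open>A3\<close> are the remaining ones, as the
    induction hypothesis requires.\<close>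
  have "similar_mat B A"
    unfolding similar_mat_def similar_mat_wit_def
    by (intro exI[of _ "W\<^sup>T"] exI[of _ W]) (use A B W WW in \<open>auto simp: B_def Let_def\<close>)
  then have "[:- e, 1:] * q = char_poly A1 * char_poly A3"
    using char_poly_similar[of B A] cp char_poly_four_block_zeros_col[OF A1 zero_carrier_mat A3]
    by (simp add: Bblock)
  also have "char_poly A1 = [:- e, 1:]"
    by (simp add: A1_def char_poly_defs det_def sign_def)
  finally have "char_poly A3 = q"
    by (metis mult_cancel_left pCons_eq_0_iff zero_neq_one)
  then obtain P where P: "P \<in> carrier_mat m m" "P\<^sup>T * P = 1\<^sub>m m" "P\<^sup>T * A3 * P = mat_diag m ((!) es)"
    using Cons.IH[OF symA3 A3] q_def by blast
  note mult_block = mult_four_block_mat[where ?nr1.0 = 1 and ?nr2.0 = m and ?n1.0 = 1 and ?n2.0 = m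
    and ?nc1.0 = 1 and ?nc2.0 = m]
  \<comment> \<open>\<open>F\<close> fixes the eigenvector already found and diagonalizes its
    complement; \<open>W * F\<close> is the final basis.\<close>
  define F where "F = four_block_mat (1\<^sub>m 1) (0\<^sub>m 1 m) (0\<^sub>m m 1) P"
  have F: "F \<in> carrier_mat n n"
    using P(1) m by (auto simp: F_def)
  have FT: "F\<^sup>T = four_block_mat (1\<^sub>m 1) (0\<^sub>m 1 m) (0\<^sub>m m 1) P\<^sup>T"
    using P(1) unfolding F_def by (subst transpose_four_block_mat) auto
  have "F\<^sup>T * F = four_block_mat (1\<^sub>m 1) (0\<^sub>m 1 m) (0\<^sub>m m 1) (1\<^sub>m m)"
    unfolding FT unfolding F_def
    using P by (subst mult_block) auto
  also have "\<dots> = 1\<^sub>m n"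
    by (rule eq_matI) (auto simp: m)
  finally have FF: "F\<^sup>T * F = 1\<^sub>m n" .
  have "F\<^sup>T * B = four_block_mat A1 (0\<^sub>m 1 m) (0\<^sub>m m 1) (P\<^sup>T * A3)"
    unfolding FT Bblock
    using P A1 A3 by (subst mult_block) auto
  then have "F\<^sup>T * B * F = four_block_mat A1 (0\<^sub>m 1 m) (0\<^sub>m m 1) (P\<^sup>T * A3 * P)"
    unfolding F_def
    using P A1 A3 by (simp, subst mult_block) auto
  also have "\<dots> = mat_diag n ((!) (e # es))"
    unfolding P(3) A1_def by (rule eq_matI) (auto simp: m mat_diag_def nth_Cons split: nat.splits)
  finally have FBF: "F\<^sup>T * B * F = mat_diag n ((!) (e # es))" .
  note assoc = assoc_mult_mat[of _ n n _ n _ n]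
  have WFT: "(W * F)\<^sup>T = F\<^sup>T * W\<^sup>T"
    using W(1) F by (rule transpose_mult)
  have "(W * F)\<^sup>T * (W * F) = F\<^sup>T * (W\<^sup>T * W) * F"
    unfolding WFT using W(1) F by (simp add: assoc)
  then have "(W * F)\<^sup>T * (W * F) = 1\<^sub>m n"
    using W(2) FF F by simp
  moreover have "(W * F)\<^sup>T * A * (W * F) = F\<^sup>T * B * F"
    unfolding WFT B_def using W(1) F A by (simp add: assoc)
  ultimately show ?case
    using FBF W(1) F by (intro bexI[of _ "W * F"]) auto
qed


section \<open>Expansions in an orthonormal eigenbasis\<close>

text \<open>The columns of \<open>P\<close> are orthonormal eigenvectors with eigenvalues
  \<open>l\<close>. Weyl's inequality instantiates this for two matrices side by side.\<close>

locale orthogonal_diagonalization =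
  fixes n :: nat and A P :: "real mat" and l :: "nat \<Rightarrow> real"
  assumes A: "A \<in> carrier_mat n n" and P: "P \<in> carrier_mat n n"
    and orth: "P\<^sup>T * P = 1\<^sub>m n" and diag: "P\<^sup>T * A * P = mat_diag n l"
begin

lemma orth': "P * P\<^sup>T = 1\<^sub>m n"
  using mat_mult_left_right_inverse[of "P\<^sup>T" n P] P orth by simp

text \<open>Parseval's identity for the columns of \<open>P\<close>.\<close>

lemma norm_expansion:
  assumes x: "x \<in> carrier_vec n"
  shows "x \<bullet> x = (\<Sum>k<n. (col P k \<bullet> x)\<^sup>2)"
proof -
  have "x \<bullet> x = x \<bullet> (P *\<^sub>v (P\<^sup>T *\<^sub>v x))"
    using P x orth' by (simp flip: assoc_mult_mat_vec[of _ n n _ n])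
  also have "\<dots> = (P\<^sup>T *\<^sub>v x) \<bullet> (P\<^sup>T *\<^sub>v x)"
    using P x by (intro transpose_vec_mult_scalar[symmetric]) auto
  also have "\<dots> = (\<Sum>k<n. (col P k \<bullet> x)\<^sup>2)"
    using P by (simp add: scalar_prod_def[of "P\<^sup>T *\<^sub>v x"] power2_eq_square atLeast0LessThan)
  finally show ?thesis .
qed

text \<open>In the coordinates \<open>P\<^sup>T *\<^sub>v x\<close> the quadratic form is
  diagonal.\<close>

lemma form_expansion:
  assumes x: "x \<in> carrier_vec n"
  shows "x \<bullet> (A *\<^sub>v x) = (\<Sum>k<n. l k * (col P k \<bullet> x)\<^sup>2)"
proof -
  let ?y = "P\<^sup>T *\<^sub>v x"
  have y: "?y \<in> carrier_vec n" and Py: "P *\<^sub>v ?y = x"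
    using P x orth' by (simp_all flip: assoc_mult_mat_vec[of _ n n _ n])
  have "x \<bullet> (A *\<^sub>v x) = (P *\<^sub>v ?y) \<bullet> (A *\<^sub>v (P *\<^sub>v ?y))"
    by (simp add: Py)
  also have "\<dots> = ?y \<bullet> (P\<^sup>T *\<^sub>v (A *\<^sub>v (P *\<^sub>v ?y)))"
    using transpose_vec_mult_scalar[of "P\<^sup>T" n n "A *\<^sub>v (P *\<^sub>v ?y)" ?y] P A y by simp
  also have "P\<^sup>T *\<^sub>v (A *\<^sub>v (P *\<^sub>v ?y)) = mat_diag n l *\<^sub>v ?y"
    unfolding diag[symmetric] using P A y by (simp add: assoc_mult_mat_vec[of _ n n _ n])
  also have "mat_diag n l *\<^sub>v ?y = vec n (\<lambda>k. l k * ?y $ k)"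
  proof (rule eq_vecI)
    fix i assume i: "i < dim_vec (vec n (\<lambda>k. l k * ?y $ k))"
    have "(mat_diag n l *\<^sub>v ?y) $ i = (\<Sum>k<n. (if i = k then l k else 0) * ?y $ k)"
      using i P by (simp add: mat_diag_def scalar_prod_def atLeast0LessThan)
    also have "\<dots> = (\<Sum>k<n. if i = k then l k * ?y $ k else 0)"
      by (intro sum.cong) auto
    finally show "(mat_diag n l *\<^sub>v ?y) $ i = vec n (\<lambda>k. l k * ?y $ k) $ i"
      using i by simp
  qed (simp add: mat_diag_def)
  also have "?y \<bullet> vec n (\<lambda>k. l k * ?y $ k) = (\<Sum>k<n. l k * (col P k \<bullet> x)\<^sup>2)"
    using P by (simp add: scalar_prod_def[of "P\<^sup>T *\<^sub>v x"] power2_eq_square atLeast0LessThan mult_ac)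
  finally show ?thesis .
qed

end

lemma spectral_theorem:
  assumes "symmetric_real_mat A" "A \<in> carrier_mat n n"
  obtains P where "orthogonal_diagonalization n A P ((!) (eigvals_desc A))"
  using spectral_theorem_of_split[OF assms char_poly_eigvals_desc[OF assms]] assms(2)
  unfolding orthogonal_diagonalization_def by blast

section \<open>Weyl's inequality\<close>

text \<open>These are \<open>n - 1\<close> linear conditions on \<open>n\<close> unknowns: replacing
  row \<open>k\<close> by zero makes the coefficient matrix singular.\<close>

lemma exists_orthogonal_vector:
  fixes c :: "nat \<Rightarrow> 'a :: field vec"
  assumes k: "k < n" and c: "\<And>i. i < n \<Longrightarrow> c i \<in> carrier_vec n"
  obtains x where "x \<in> carrier_vec n" "x \<noteq> 0\<^sub>v n" "\<And>i. i < n \<Longrightarrow> i \<noteq> k \<Longrightarrow> c i \<bullet> x = 0"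
proof -
  let ?M = "mat\<^sub>r n n (\<lambda>i. if i = k then 0\<^sub>v n else c i)"
  have "det ?M = 0"
    using k c by (intro det_row_0) auto
  then obtain x where x: "x \<in> carrier_vec n" "x \<noteq> 0\<^sub>v n" "?M *\<^sub>v x = 0\<^sub>v n"
    using det_0_iff_vec_prod_zero[of ?M n] by (metis mat_row_carrierI)
  have "c i \<bullet> x = 0" if "i < n" "i \<noteq> k" for i
  proof -
    have "row ?M i = c i"
      using that c[of i] by (subst row_mat_of_row_fun) auto
    moreover have "(?M *\<^sub>v x) $ i = row ?M i \<bullet> x"
      using that by (intro index_mult_mat_vec) simp
    ultimately show ?thesis
      using x(3) that by simp
  qed
  with that x show ?thesis by blast
qed

lemma weyl_one_sided:
  assumes A: "symmetric_real_mat A" "A \<in> carrier_mat n n"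
    and B: "symmetric_real_mat B" "B \<in> carrier_mat n n"
    and le: "\<And>x. x \<in> carrier_vec n \<Longrightarrow> x \<bullet> (A *\<^sub>v x) \<le> x \<bullet> (B *\<^sub>v x) + r * (x \<bullet> x)"
    and k: "k < n"
  shows "eigvals_desc A ! k \<le> eigvals_desc B ! k + r"
proof -
  \<comment> \<open>Instead of intersecting the spans of the first \<open>k + 1\<close> eigenvectors of \<open>A\<close> and of the eigenvectors
    of \<open>B\<close> from index \<open>k\<close> on, choose \<open>x\<close> orthogonal to the \<open>n - 1\<close> remaining eigenvectors.\<close>
  obtain P where "orthogonal_diagonalization n A P ((!) (eigvals_desc A))"
    using spectral_theorem[OF A] .
  then interpret a: orthogonal_diagonalization n A P "(!) (eigvals_desc A)" .
  obtain Q where "orthogonal_diagonalization n B Q ((!) (eigvals_desc B))"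
    using spectral_theorem[OF B] .
  then interpret b: orthogonal_diagonalization n B Q "(!) (eigvals_desc B)" .
  obtain x where x: "x \<in> carrier_vec n" "x \<noteq> 0\<^sub>v n"
    and x0: "\<And>i. i < n \<Longrightarrow> i \<noteq> k \<Longrightarrow> (if i < k then col Q i else col P i) \<bullet> x = 0"
    by (rule exists_orthogonal_vector[OF k, of "\<lambda>i. if i < k then col Q i else col P i"])
      (use a.P b.P in auto)
  \<comment> \<open>Only eigenvectors of \<open>A\<close> with index at most \<open>k\<close> occur
    in \<open>x\<close>, and their eigenvalues are at least the one at \<open>k\<close>.\<close>
  have "eigvals_desc A ! k * (x \<bullet> x) \<le> x \<bullet> (A *\<^sub>v x)"
    unfolding a.norm_expansion[OF x(1)] a.form_expansion[OF x(1)] sum_distrib_left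
  proof (rule sum_mono)
    fix i assume i: "i \<in> {..<n}"
    show "eigvals_desc A ! k * (col P i \<bullet> x)\<^sup>2 \<le> eigvals_desc A ! i * (col P i \<bullet> x)\<^sup>2"
    proof (cases "i \<le> k")
      case True
      then show ?thesis
        using eigvals_desc_antimono[of i k A] k length_eigvals_desc[OF A] by (intro mult_right_mono) auto
    next
      case False
      then show ?thesis
        using x0[of i] i by simp
    qed
  qed
  also have "\<dots> \<le> x \<bullet> (B *\<^sub>v x) + r * (x \<bullet> x)"
    by (rule le[OF x(1)])
  \<comment> \<open>Dually, only eigenvectors of \<open>B\<close> with index at least
    \<open>k\<close> occur in \<open>x\<close>.\<close>
  also have "x \<bullet> (B *\<^sub>v x) \<le> eigvals_desc B ! k * (x \<bullet> x)"
    unfolding b.norm_expansion[OF x(1)] b.form_expansion[OF x(1)] sum_distrib_left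
  proof (rule sum_mono)
    fix i assume i: "i \<in> {..<n}"
    show "eigvals_desc B ! i * (col Q i \<bullet> x)\<^sup>2 \<le> eigvals_desc B ! k * (col Q i \<bullet> x)\<^sup>2"
    proof (cases "k \<le> i")
      case True
      then show ?thesis
        using eigvals_desc_antimono[of k i B] i length_eigvals_desc[OF B] by (intro mult_right_mono) auto
    next
      case False
      then show ?thesis
        using x0[of i] i by simp
    qed
  qed
  finally have "eigvals_desc A ! k * (x \<bullet> x) \<le> (eigvals_desc B ! k + r) * (x \<bullet> x)"
    by (simp add: distrib_right)
  then show ?thesis
    using scalar_prod_self_pos[OF x] by simp
qed

lemma weyl:
  assumes A: "symmetric_real_mat A" "A \<in> carrier_mat n n"
    and B: "symmetric_real_mat B" "B \<in> carrier_mat n n"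
    and le: "\<And>x. x \<in> carrier_vec n \<Longrightarrow> \<bar>x \<bullet> (A *\<^sub>v x) - x \<bullet> (B *\<^sub>v x)\<bar> \<le> r * (x \<bullet> x)"
    and k: "k < n"
  shows "\<bar>eigvals_desc A ! k - eigvals_desc B ! k\<bar> \<le> r"
proof -
  have "eigvals_desc A ! k \<le> eigvals_desc B ! k + r"
    by (rule weyl_one_sided[OF A B _ k]) (use le in \<open>force simp: abs_le_iff\<close>)
  moreover have "eigvals_desc B ! k \<le> eigvals_desc A ! k + r"
    by (rule weyl_one_sided[OF B A _ k]) (use le in \<open>force simp: abs_le_iff\<close>)
  ultimately show ?thesis by linarith
qed

section \<open>The Schur test and sparse rows\<close>

text \<open>Weighted AM-GM splits each product into two squares with weights
  \<open>p j / p i\<close> and \<open>p i / p j\<close>; the row sums against \<open>p\<close> then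
  bound each half.\<close>

lemma schur_test:
  fixes a :: "nat \<Rightarrow> nat \<Rightarrow> real" and p x :: "nat \<Rightarrow> real"
  assumes nonneg: "\<And>i j. i < n \<Longrightarrow> j < n \<Longrightarrow> 0 \<le> a i j"
    and sym: "\<And>i j. i < n \<Longrightarrow> j < n \<Longrightarrow> a i j = a j i"
    and pos: "\<And>i. i < n \<Longrightarrow> 0 < p i"
    and row: "\<And>i. i < n \<Longrightarrow> (\<Sum>j<n. a i j * p j) \<le> l * p i"
  shows "(\<Sum>i<n. \<Sum>j<n. a i j * (\<bar>x i\<bar> * \<bar>x j\<bar>)) \<le> l * (\<Sum>i<n. (x i)\<^sup>2)"
proof -
  have amgm: "\<bar>x i\<bar> * \<bar>x j\<bar> \<le> ((x i)\<^sup>2 * p j / p i + (x j)\<^sup>2 * p i / p j) / 2"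
    if "i < n" "j < n" for i j
  proof -
    have "0 \<le> (\<bar>x i\<bar> * p j - \<bar>x j\<bar> * p i)\<^sup>2 / (p i * p j)"
      using pos that by (simp add: less_imp_le)
    also have "\<dots> = (x i)\<^sup>2 * p j / p i + (x j)\<^sup>2 * p i / p j - 2 * (\<bar>x i\<bar> * \<bar>x j\<bar>)"
      using pos[OF that(1)] pos[OF that(2)] by (simp add: field_simps power2_diff power_mult_distrib)
        (simp add: power2_eq_square algebra_simps)
    finally show ?thesis by simp
  qed
  have "(\<Sum>i<n. \<Sum>j<n. a i j * (\<bar>x i\<bar> * \<bar>x j\<bar>))
      \<le> (\<Sum>i<n. \<Sum>j<n. a i j * (((x i)\<^sup>2 * p j / p i + (x j)\<^sup>2 * p i / p j) / 2))"
    by (intro sum_mono mult_left_mono amgm nonneg) auto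
  also have "\<dots> = (\<Sum>i<n. \<Sum>j<n. a i j * ((x i)\<^sup>2 * p j / p i)) / 2
      + (\<Sum>i<n. \<Sum>j<n. a i j * ((x j)\<^sup>2 * p i / p j)) / 2"
    by (simp add: sum.distrib add_divide_distrib distrib_left sum_divide_distrib)
  \<comment> \<open>Exchanging \<open>i\<close> and \<open>j\<close> makes the two halves equal, by
    symmetry of \<open>a\<close>.\<close>
  also have "(\<Sum>i<n. \<Sum>j<n. a i j * ((x j)\<^sup>2 * p i / p j)) = (\<Sum>i<n. \<Sum>j<n. a i j * ((x i)\<^sup>2 * p j / p i))"
    by (subst sum.swap, intro sum.cong refl, subst sym) auto
  also have "(\<Sum>i<n. \<Sum>j<n. a i j * ((x i)\<^sup>2 * p j / p i)) = (\<Sum>i<n. (x i)\<^sup>2 / p i * (\<Sum>j<n. a i j * p j))"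
    by (simp add: sum_distrib_left mult_ac)
  also have "\<dots> \<le> (\<Sum>i<n. (x i)\<^sup>2 / p i * (l * p i))"
    using pos row by (intro sum_mono mult_left_mono) (auto simp: less_imp_le)
  also have "\<dots> = l * (\<Sum>i<n. (x i)\<^sup>2)"
    unfolding sum_distrib_left by (intro sum.cong refl) (use pos in \<open>force simp: field_simps\<close>)
  finally show ?thesis by simp
qed

lemma form_double_sum:
  assumes "M \<in> carrier_mat n n" "x \<in> carrier_vec n"
  shows "x \<bullet> (M *\<^sub>v x) = (\<Sum>i<n. \<Sum>j<n. M $$ (i, j) * (x $ i * (x $ j :: real)))"
  using assms by (simp add: scalar_prod_def sum_distrib_left mult_ac atLeast0LessThan)

lemma form_difference_le:
  assumes A: "symmetric_real_mat A" "A \<in> carrier_mat n n"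
    and bound: "\<And>i j. i < n \<Longrightarrow> j < n \<Longrightarrow> \<bar>A $$ (i, j)\<bar> \<le> 1"
    and B: "B \<in> carrier_mat n n"
    and entries: "\<And>i j. i < n \<Longrightarrow> j < n \<Longrightarrow> B $$ (i, j) =
      (if i = j \<or> real (nnz_vec (row A i)) * real (nnz_vec (row A j)) < t then 0 else A $$ (i, j))"
    and x: "x \<in> carrier_vec n"
    and t: "0 \<le> t"
  shows "\<bar>x \<bullet> (A *\<^sub>v x) - x \<bullet> (B *\<^sub>v x)\<bar> \<le> (1 + sqrt t) * (x \<bullet> x)"
proof -
  define d where "d i = nnz_vec (row A i)" for i
  define a where "a i j = \<bar>A $$ (i, j) - B $$ (i, j)\<bar>" for i j
  \<comment> \<open>The maximum keeps the weights positive on zero rows.\<close>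
  define p where "p i = max 1 (sqrt (d i))" for i
  have d: "d i = card {j. j < n \<and> A $$ (i, j) \<noteq> 0}" if "i < n" for i
    unfolding d_def nnz_vec_def using that A(2) by (intro arg_cong[where f = card]) auto
  have d_pos: "1 \<le> d i" if "i < n" "j < n" "A $$ (i, j) \<noteq> 0" for i j
    using d[OF that(1)] that card_gt_0_iff[of "{j. j < n \<and> A $$ (i, j) \<noteq> 0}"] by auto
  note sym = symmetric_real_matD[OF A]
  have row: "(\<Sum>j<n. a i j * p j) \<le> (1 + sqrt t) * p i" if i: "i < n" for i
  proof -
    \<comment> \<open>The first term pays for the diagonal entry. The second is charged to every
      nonzero entry of row \<open>i\<close>, removed or not, so that exactly \<open>d i\<close>
      copies appear in the sum.\<close>
    have summand: "a i j * p j \<le> (if j = i then p i else 0)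
        + (if A $$ (i, j) \<noteq> 0 then sqrt t / sqrt (d i) else 0)"
      if j: "j < n" for j
    proof (cases "j = i")
      case True
      have "a i i * p i \<le> 1 * p i"
        using bound[OF i i] entries[OF i i] by (intro mult_right_mono) (auto simp: a_def p_def)
      then show ?thesis
        using True t by (simp add: add_increasing2)
    next
      case False
      show ?thesis
      proof (cases "A $$ (i, j) \<noteq> 0 \<and> real (d i) * real (d j) < t")
        case True
        \<comment> \<open>By symmetry the entry is also nonzero in row \<open>j\<close>; hence
          \<open>p j\<close> is just \<open>sqrt (d j)\<close>.\<close>
        have di: "1 \<le> d i" and dj: "1 \<le> d j"
          using d_pos[OF i j] d_pos[OF j i] True sym[OF i j] by auto
        have "a i j * p j \<le> 1 * p j"
          using bound[OF i j] entries[OF i j] by (intro mult_right_mono) (auto simp: a_def p_def)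
        also have "1 * p j = sqrt (d j)"
          using dj by (simp add: p_def)
        also have "\<dots> \<le> sqrt t / sqrt (d i)"
          using True di by (simp add: pos_le_divide_eq mult.commute flip: real_sqrt_mult)
        finally show ?thesis
          using True False by simp
      next
        case small: False
        \<comment> \<open>Off the diagonal, such an entry is zero in \<open>A\<close> or kept in
          \<open>B\<close>.\<close>
        then have "a i j = 0"
          using entries[OF i j] False by (auto simp: a_def d_def)
        then show ?thesis
          using t False by simp
      qed
    qed
    have "(\<Sum>j<n. a i j * p j)
        \<le> (\<Sum>j<n. (if j = i then p i else 0)
          + (if A $$ (i, j) \<noteq> 0 then sqrt t / sqrt (d i) else 0))"
      by (intro sum_mono summand) simp
    also have "\<dots> = p i + d i * (sqrt t / sqrt (d i))"
      using i by (simp add: sum.distrib d[OF i] flip: sum.inter_filter)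
    \<comment> \<open>This covers zero rows as well, where both sides are 0.\<close>
    also have "d i * (sqrt t / sqrt (d i)) = sqrt t * sqrt (d i)"
      by (metis (no_types) mult.commute of_nat_0_le_iff real_div_sqrt times_divide_eq_left times_divide_eq_right)
    also have "\<dots> \<le> sqrt t * p i"
      using t by (intro mult_left_mono) (auto simp: p_def)
    finally show ?thesis
      by (simp add: distrib_right)
  qed
  have "x \<bullet> (A *\<^sub>v x) - x \<bullet> (B *\<^sub>v x) = (\<Sum>i<n. \<Sum>j<n. (A $$ (i, j) - B $$ (i, j)) * (x $ i * x $ j))"
    by (simp add: form_double_sum[OF A(2) x] form_double_sum[OF B x] left_diff_distrib sum_subtractf)
  also have "\<bar>\<dots>\<bar> \<le> (\<Sum>i<n. \<Sum>j<n. a i j * (\<bar>x $ i\<bar> * \<bar>x $ j\<bar>))"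
    unfolding a_def by (intro order.trans[OF sum_abs] sum_mono) (simp add: abs_mult)
  also have "\<dots> \<le> (1 + sqrt t) * (\<Sum>i<n. (x $ i)\<^sup>2)"
  proof (rule schur_test[where p = p])
    show "a i j = a j i" if "i < n" "j < n" for i j
      using sym[OF that] entries[OF that] entries[OF that(2,1)] by (simp add: a_def mult.commute eq_commute)
  qed (use row in \<open>auto simp: a_def p_def\<close>)
  also have "(\<Sum>i<n. (x $ i)\<^sup>2) = x \<bullet> x"
    using x by (simp add: scalar_prod_def power2_eq_square atLeast0LessThan)
  finally show ?thesis .
qed

lemma max_abs_entry_ge:
  assumes "A \<in> carrier_mat n m" "i < n" "j < m"
  shows "\<bar>A $$ (i, j)\<bar> \<le> max_abs_entry A"
proof -
  have "finite (elements_mat A)" "A $$ (i, j) \<in> elements_mat A"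
    using assms by (simp add: elements_mat_def, blast)
  then show ?thesis
    unfolding max_abs_entry_def by (intro Max_ge) auto
qed

text \<open>The target is split into three quarters for the diagonal term 1 and one quarter for the
  square root.\<close>

lemma radius_bound:
  fixes \<epsilon> s c L :: real
  assumes "0 < \<epsilon>" "2 / \<epsilon>\<^sup>2 \<le> s" "16 \<le> c" "1 \<le> L"
  shows "1 + sqrt (\<epsilon>\<^sup>2 * s / (c * L\<^sup>2)) \<le> \<epsilon> * sqrt s"
proof -
  have s: "0 \<le> s"
    using assms(2) by (rule order.trans[rotated]) simp
  have es: "\<epsilon> * sqrt s = sqrt (\<epsilon>\<^sup>2 * s)"
    using assms(1) by (simp add: real_sqrt_mult)
  have "16 * 1 \<le> c * L\<^sup>2"
    using assms(3,4) by (intro mult_mono) auto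
  then have "\<epsilon>\<^sup>2 * s / (c * L\<^sup>2) \<le> \<epsilon>\<^sup>2 * s / 16"
    using s by (intro divide_left_mono) auto
  then have "sqrt (\<epsilon>\<^sup>2 * s / (c * L\<^sup>2)) \<le> sqrt (\<epsilon>\<^sup>2 * s) / sqrt 16"
    by (metis real_sqrt_divide real_sqrt_le_mono)
  also have "sqrt 16 = (4 :: real)"
    by (rule real_sqrt_unique) auto
  finally have "sqrt (\<epsilon>\<^sup>2 * s / (c * L\<^sup>2)) \<le> sqrt (\<epsilon>\<^sup>2 * s) / 4" .
  \<comment> \<open>The square of 4/3 is 16/9, which is below 2 \<le>
    \<open>\<epsilon>\<^sup>2 * s\<close>.\<close>
  moreover have "4 / 3 \<le> sqrt (\<epsilon>\<^sup>2 * s)"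
    using assms(1,2) by (intro real_le_rsqrt) (simp add: field_simps power2_eq_square)
  ultimately show ?thesis
    unfolding es by linarith
qed

theorem lemma5:
  shows "\<exists>C\<^sub>0 :: real. C\<^sub>0 > 0 \<and> (\<forall>c\<^sub>2 \<ge> C\<^sub>0. \<forall>(\<epsilon> :: real) (n :: nat) (A :: real mat) (A' :: real mat).
    0 < \<epsilon> \<longrightarrow> \<epsilon> < 1 \<longrightarrow>
    A \<in> carrier_mat n n \<longrightarrow> symmetric_real_mat A \<longrightarrow> max_abs_entry A \<le> 1 \<longrightarrow>
    real (nnz_mat A) \<ge> 2 / \<epsilon>\<^sup>2 \<longrightarrow>
    A' \<in> carrier_mat n n \<longrightarrow>
    (\<forall>i < n. \<forall>j < n. A' $$ (i, j) =
       (if i = j \<or> real (nnz_vec (row A i)) * real (nnz_vec (row A j))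
                     < \<epsilon>\<^sup>2 * real (nnz_mat A) / (c\<^sub>2 * (trunc_log (real n))\<^sup>2)
        then 0 else A $$ (i, j))) \<longrightarrow>
    (\<forall>i \<in> {1..n}. \<bar>eigval_desc A i - eigval_desc A' i\<bar> \<le> \<epsilon> * sqrt (real (nnz_mat A))))"
\<comment> \<open>The witness is the square of 4, which yields the quarter for
  \<open>sqrt t\<close>.\<close>
proof (intro exI[of _ 16] conjI allI impI ballI)
  fix c \<epsilon> :: real and n :: nat and A A' :: "real mat" and i :: nat
  define t where "t = \<epsilon>\<^sup>2 * real (nnz_mat A) / (c * (trunc_log (real n))\<^sup>2)"
  assume c: "16 \<le> c" and \<epsilon>: "0 < \<epsilon>" and A: "A \<in> carrier_mat n n" "symmetric_real_mat A"
    and max: "max_abs_entry A \<le> 1" and nnz: "2 / \<epsilon>\<^sup>2 \<le> real (nnz_mat A)"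
    and A': "A' \<in> carrier_mat n n" and i: "i \<in> {1..n}"
    and "\<forall>i < n. \<forall>j < n. A' $$ (i, j) =
       (if i = j \<or> real (nnz_vec (row A i)) * real (nnz_vec (row A j))
                     < \<epsilon>\<^sup>2 * real (nnz_mat A) / (c * (trunc_log (real n))\<^sup>2)
        then 0 else A $$ (i, j))"
  then have entries: "A' $$ (i, j) =
      (if i = j \<or> real (nnz_vec (row A i)) * real (nnz_vec (row A j)) < t then 0 else A $$ (i, j))"
    if "i < n" "j < n" for i j
    using that unfolding t_def by blast
  \<comment> \<open>The removal condition is symmetric in the two indices.\<close>
  have sym': "symmetric_real_mat A'"
    unfolding symmetric_real_mat_def
    using A' entries symmetric_real_matD[OF A(2,1)]
    by (intro eq_matI) (auto simp: mult.commute eq_commute)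
  have "0 \<le> t"
    using c by (simp add: t_def)
  \<comment> \<open>The maximum in \<open>trunc_log\<close> keeps the logarithm at least 1, also for
    small \<open>n\<close>.\<close>
  have "1 + sqrt t \<le> \<epsilon> * sqrt (real (nnz_mat A))"
    unfolding t_def by (rule radius_bound[OF \<epsilon> nnz c]) (simp add: trunc_log_def)
  \<comment> \<open>The 1-based index \<open>i\<close> becomes the list position
    \<open>i - 1\<close>, which is below \<open>n\<close> because 1 \<le> \<open>i\<close> \<le>
    \<open>n\<close>.\<close>
  moreover have "\<bar>eigvals_desc A ! (i - 1) - eigvals_desc A' ! (i - 1)\<bar> \<le> 1 + sqrt t"
  proof (rule weyl[OF A(2,1) sym' A'])
    show "\<bar>x \<bullet> (A *\<^sub>v x) - x \<bullet> (A' *\<^sub>v x)\<bar> \<le> (1 + sqrt t) * (x \<bullet> x)" if "x \<in> carrier_vec n" for x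
    proof (rule form_difference_le[OF A(2,1) _ A' entries that \<open>0 \<le> t\<close>])
      show "\<bar>A $$ (i, j)\<bar> \<le> 1" if "i < n" "j < n" for i j
        using max_abs_entry_ge[OF A(1) that] max by linarith
    qed
  qed (use i in auto)
  ultimately show "\<bar>eigval_desc A i - eigval_desc A' i\<bar> \<le> \<epsilon> * sqrt (real (nnz_mat A))"
    unfolding eigval_desc_def by linarith
qed simp

end
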